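(* Let $1\le\alpha\le 2$. No online algorithm for GEEWE achieves a competitive ratio better than $\frac{\alpha+1}{2}$, even when restricted to instances whose graph is a complete graph and all of whose edges are announced with the uniform interval $[1,\alpha]$: for every $c<\frac{\alpha+1}{2}$ and every online algorithm there is such an instance on which the algorithm's cost exceeds $c\cdot\mathrm{OPT}$.
   Context: Graph Exploration with Edge Weight Estimates (GEEWE): An instance consists of a connected graph $G=(V,E)$, for every edge $e$ a lower bound $\ell(e)$ and an upper bound $u(e)$, a start vertex $s$ and an end vertex $t$, and (hidden) actual weights $w(e)\in[\ell(e),u(e)]$. An online algorithm knows $G$, $s$, $t$ and all bounds in advance; the actual weight $w(e)$ is revealed as soon as the agent visits a vertex incident to $e$. The agent, starting at $s$, must perform a walk (repetitions allowed) ending at $t$ that visits all vertices; its cost is the sum of actual weights of the traversed edges with multiplicity. $\mathrm{OPT}$ is the minimum cost of such a walk when all actual weights are known. Competitive ratio at most $c$ means cost $\le c\cdot\mathrm{OPT}$ on every instance of the considered class. *)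

theory Defs
  imports Complex_Main "HOL-Library.Infinite_Typeclass"
begin

text \<open>
  The announced part of an instance. Edges are two-element vertex sets; bounds (and weights) are
  functions on vertex sets of which only the values on edges are meaningful.
\<close>

record 'v geewe_input =
  vertices :: "'v set"
  edges :: "'v set set"
  lower :: "'v set \<Rightarrow> real"
  upper :: "'v set \<Rightarrow> real"
  start :: 'v
  target :: 'v

definition is_walk :: "'v geewe_input \<Rightarrow> 'v list \<Rightarrow> bool" where
  "is_walk I p \<longleftrightarrow>
     p \<noteq> [] \<and> set p \<subseteq> vertices I \<and> successively (\<lambda>x y. {x, y} \<in> edges I) p"

definition connected_graph :: "'v geewe_input \<Rightarrow> bool" where
  "connected_graph I \<longleftrightarrow>
     (\<forall>x\<in>vertices I. \<forall>y\<in>vertices I. \<exists>p. is_walk I p \<and> hd p = x \<and> last p = y)"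

definition geewe_instance :: "'v geewe_input \<Rightarrow> ('v set \<Rightarrow> real) \<Rightarrow> bool" where
  "geewe_instance I w \<longleftrightarrow>
     finite (vertices I) \<and>
     edges I \<subseteq> {e. e \<subseteq> vertices I \<and> card e = 2} \<and>
     connected_graph I \<and>
     start I \<in> vertices I \<and> target I \<in> vertices I \<and>
     (\<forall>e\<in>edges I. lower I e \<le> w e \<and> w e \<le> upper I e)"

definition exploration_walk :: "'v geewe_input \<Rightarrow> 'v list \<Rightarrow> bool" where
  "exploration_walk I p \<longleftrightarrow>
     is_walk I p \<and> hd p = start I \<and> last p = target I \<and> set p = vertices I"

definition walk_cost :: "('v set \<Rightarrow> real) \<Rightarrow> 'v list \<Rightarrow> real" where
  "walk_cost w p = (\<Sum>(x, y)\<leftarrow>zip p (tl p). w {x, y})"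

text \<open>For positive weights the infimum is a minimum, see \<open>opt_attained\<close> below.\<close>

definition opt :: "'v geewe_input \<Rightarrow> ('v set \<Rightarrow> real) \<Rightarrow> real" where
  "opt I w = (INF p\<in>{p. exploration_walk I p}. walk_cost w p)"

text \<open>
  A deterministic online algorithm maps the announced input, the walk performed so far and the
  weights revealed so far to the next vertex, or to \<open>None\<close> if the agent stops. The order in which
  weights were revealed can be read off from the walk.
\<close>

type_synonym 'v online_algorithm =
  "'v geewe_input \<Rightarrow> 'v list \<Rightarrow> ('v set \<rightharpoonup> real) \<Rightarrow> 'v option"

definition revealed :: "'v geewe_input \<Rightarrow> ('v set \<Rightarrow> real) \<Rightarrow> 'v list \<Rightarrow> 'v set \<rightharpoonup> real" where
  "revealed I w p = (Some \<circ> w) |` {e \<in> edges I. e \<inter> set p \<noteq> {}}"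

inductive performs ::
  "'v online_algorithm \<Rightarrow> 'v geewe_input \<Rightarrow> ('v set \<Rightarrow> real) \<Rightarrow> 'v list \<Rightarrow> bool"
  for A I w where
  init: "performs A I w [start I]"
| move: "performs A I w p \<Longrightarrow> A I p (revealed I w p) = Some v \<Longrightarrow> performs A I w (p @ [v])"

text \<open>
  The complete walk of a terminating run. Runs are deterministic, so there is at most one such
  \<open>p\<close>; a move along a non-edge is possible here but makes \<open>p\<close> violate \<open>exploration_walk\<close>.
\<close>

definition outputs ::
  "'v online_algorithm \<Rightarrow> 'v geewe_input \<Rightarrow> ('v set \<Rightarrow> real) \<Rightarrow> 'v list \<Rightarrow> bool" where
  "outputs A I w p \<longleftrightarrow> performs A I w p \<and> A I p (revealed I w p) = None"

definition solves ::
  "'v online_algorithm \<Rightarrow> 'v geewe_input \<Rightarrow> ('v set \<Rightarrow> real) \<Rightarrow> bool" where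
  "solves A I w \<longleftrightarrow> (\<exists>p. outputs A I w p \<and> exploration_walk I p)"

definition uniform_complete_instance ::
  "real \<Rightarrow> 'v geewe_input \<Rightarrow> ('v set \<Rightarrow> real) \<Rightarrow> bool" where
  "uniform_complete_instance \<alpha> I w \<longleftrightarrow>
     geewe_instance I w \<and>
     edges I = {e. e \<subseteq> vertices I \<and> card e = 2} \<and>
     (\<forall>e\<in>edges I. lower I e = 1 \<and> upper I e = \<alpha>)"

lemma is_walk_join:
  assumes "is_walk I p" "is_walk I q" "last p = hd q"
  shows "is_walk I (p @ tl q)" "hd (p @ tl q) = hd p" "last (p @ tl q) = last q"
    "set (p @ tl q) = set p \<union> set q"
proof -
  from assms(2) obtain x r where q: "q = x # r"
    by (cases q) (auto simp: is_walk_def)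
  have x: "x = last p" "p \<noteq> []" using assms q by (auto simp: is_walk_def)
  show "is_walk I (p @ tl q)"
    using assms unfolding is_walk_def q
    by (cases r) (auto simp: successively_append_iff)
  show "hd (p @ tl q) = hd p" "last (p @ tl q) = last q" "set (p @ tl q) = set p \<union> set q"
    using x q by auto
qed

lemma exploration_walk_exists:
  assumes "geewe_instance I w"
  shows "\<exists>p. exploration_walk I p"
proof -
  have con: "\<exists>p. is_walk I p \<and> hd p = x \<and> last p = y" if "x \<in> vertices I" "y \<in> vertices I" for x y
    using assms that by (auto simp: geewe_instance_def connected_graph_def)
  have fin: "finite (vertices I)" and s: "start I \<in> vertices I" and t: "target I \<in> vertices I"
    using assms by (auto simp: geewe_instance_def)
  have step: "\<exists>r. is_walk I r \<and> hd r = hd p \<and> last r = y \<and> insert y (set p) \<subseteq> set r"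
    if p: "is_walk I p" and y: "y \<in> vertices I" for p y
  proof -
    have "last p \<in> vertices I" using p last_in_set by (auto simp: is_walk_def)
    then obtain q where q: "is_walk I q" "hd q = last p" "last q = y" using con y by blast
    have "y \<in> set q" using q last_in_set by (auto simp: is_walk_def)
    then show ?thesis
      using is_walk_join[OF p q(1) q(2)[symmetric]] q by (intro exI[of _ "p @ tl q"]) auto
  qed
  have "\<exists>p. is_walk I p \<and> hd p = start I \<and> S \<subseteq> set p" if "finite S" "S \<subseteq> vertices I" for S
    using that
  proof (induction S rule: finite_induct)
    case empty
    then show ?case using con[OF s s] by auto
  next
    case (insert y S)
    then obtain p where p: "is_walk I p" "hd p = start I" "S \<subseteq> set p" by auto
    then show ?case using step[OF p(1), of y] insert.prems by fastforce
  qed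
  from this[OF fin order_refl] obtain p where
    p: "is_walk I p" "hd p = start I" "vertices I \<subseteq> set p" by blast
  then obtain r where r: "is_walk I r" "hd r = start I" "last r = target I" "set p \<subseteq> set r"
    using step[OF p(1) t] by auto
  then show ?thesis using p
    by (intro exI[of _ r]) (auto simp: exploration_walk_def is_walk_def)
qed

lemma walk_cost_Cons:
  "walk_cost w (x # y # p) = w {x, y} + walk_cost w (y # p)"
  by (simp add: walk_cost_def)

lemma walk_cost_ge_length:
  assumes "\<forall>e\<in>edges I. m \<le> w e" "is_walk I p"
  shows "m * (real (length p) - 1) \<le> walk_cost w p"
  using assms(2)
proof (induction p rule: induct_list012)
  case (3 x y p)
  then have "is_walk I (y # p)" "{x, y} \<in> edges I" by (auto simp: is_walk_def)
  then have "m * (real (length (y # p)) - 1) \<le> walk_cost w (y # p)" "m \<le> w {x, y}"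
    using 3 assms(1) by auto
  then show ?case by (simp add: walk_cost_Cons algebra_simps)
qed (auto simp: is_walk_def walk_cost_def)

lemma opt_attained:
  assumes I: "geewe_instance I w" and pos: "\<forall>e\<in>edges I. 0 < w e"
  shows "\<exists>p. exploration_walk I p \<and> walk_cost w p = opt I w \<and>
           (\<forall>q. exploration_walk I q \<longrightarrow> walk_cost w p \<le> walk_cost w q)"
proof -
  have fV: "finite (vertices I)" using I by (auto simp: geewe_instance_def)
  have "edges I \<subseteq> Pow (vertices I)" using I by (auto simp: geewe_instance_def)
  then have fE: "finite (edges I)" using fV finite_subset by blast
  define m where "m = Min (insert 1 (w ` edges I))"
  have m: "m > 0" "\<forall>e\<in>edges I. m \<le> w e"
    using fE pos by (auto simp: m_def Min_gr_iff)
  obtain p0 where p0: "exploration_walk I p0" using exploration_walk_exists[OF I] by blast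
  define S where "S = {p. exploration_walk I p \<and> walk_cost w p \<le> walk_cost w p0}"
  have "S \<subseteq> {p. set p \<subseteq> vertices I \<and> length p \<le> nat \<lceil>walk_cost w p0 / m + 1\<rceil>}"
  proof
    fix p assume "p \<in> S"
    then have p: "is_walk I p" "walk_cost w p \<le> walk_cost w p0"
      by (auto simp: S_def exploration_walk_def)
    have "m * (real (length p) - 1) \<le> walk_cost w p0"
      using walk_cost_ge_length[OF m(2) p(1)] p(2) by linarith
    then have "real (length p) \<le> walk_cost w p0 / m + 1"
      using m(1) by (simp add: field_simps)
    then show "p \<in> {p. set p \<subseteq> vertices I \<and> length p \<le> nat \<lceil>walk_cost w p0 / m + 1\<rceil>}"
      using p(1) by (auto simp: is_walk_def) linarith
  qed
  then have "finite S" using finite_lists_length_le[OF fV] finite_subset by blast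
  moreover have "S \<noteq> {}" using p0 by (auto simp: S_def)
  ultimately obtain p where p: "p \<in> S" "\<forall>q\<in>S. walk_cost w p \<le> walk_cost w q"
    using ex_min_if_finite[of "walk_cost w ` S"] by (fastforce simp: not_less)
  have le: "walk_cost w p \<le> walk_cost w q" if "exploration_walk I q" for q
    using p that by (cases "q \<in> S") (auto simp: S_def)
  have "opt I w = walk_cost w p"
    unfolding opt_def using p(1) le
    by (intro cInf_eq_minimum) (auto simp: S_def)
  then show ?thesis using p(1) le by (auto simp: S_def)
qed

end

theory Submission
  imports Defs
begin

text \<open>
  The adversary makes the edges from a newly visited vertex to all unvisited vertices alternately
  cheap (weight 1) and expensive (weight \<open>\<alpha>\<close>). As a detour over a second edge costs at least
  \<open>2 \<ge> \<alpha>\<close>, the agent pays \<open>1\<close> and \<open>\<alpha>\<close> alternately for reaching new vertices. If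
  \<open>\<sigma> 0, \<sigma> 1, \<dots>, \<sigma> (2m - 1)\<close> is the order of first visits, however, an edge is cheap whenever its
  smaller index is even, so the closed walk visiting the indices
  \<open>0, 1, 0, 3, 2, 5, 4, \<dots>, 2m - 1, 2m - 2, 0\<close> uses \<open>2m + 1\<close> cheap edges only.
\<close>

section \<open>Runs of online algorithms\<close>

lemma walk_cost_snoc:
  assumes "p \<noteq> []"
  shows "walk_cost w (p @ [v]) = walk_cost w p + w {last p, v}"
  using assms
proof (induction p rule: induct_list012)
  case (3 x y p)
  then show ?case by (simp add: walk_cost_Cons)
qed (auto simp: walk_cost_def)

lemma revealed_cong:
  assumes "\<And>e. e \<in> edges I \<Longrightarrow> e \<inter> set p \<noteq> {} \<Longrightarrow> w e = w' e"
  shows "revealed I w p = revealed I w' p"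
  using assms by (auto simp: revealed_def restrict_map_def fun_eq_iff)

text \<open>Weights first revealed at the last vertex have not influenced any move yet, hence
  \<open>butlast\<close>. This lets the adversary price the edges of a vertex after the agent has
  moved there.\<close>

lemma performs_cong:
  assumes "performs A I w p"
    and "\<And>e. e \<in> edges I \<Longrightarrow> e \<inter> set (butlast p) \<noteq> {} \<Longrightarrow> w e = w' e"
  shows "performs A I w' p"
  using assms
proof (induction rule: performs.induct)
  case init
  show ?case by (rule performs.init)
next
  case (move p v)
  have agree: "w e = w' e" if "e \<in> edges I" "e \<inter> set p \<noteq> {}" for e
    using move.prems that by simp
  have "performs A I w' p"
    by (rule move.IH) (use agree in \<open>blast dest: in_set_butlastD\<close>)
  moreover have "A I p (revealed I w' p) = Some v"
    using move.hyps revealed_cong[of I p w w'] agree by simp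
  ultimately show ?case by (rule performs.move)
qed

lemma performs_start: "performs A I w p \<Longrightarrow> \<exists>r. p = start I # r"
  by (induction rule: performs.induct) auto

lemma performs_prefix:
  assumes "performs A I w (p @ x # r)" "p \<noteq> []"
  shows "performs A I w (p @ [x])" "A I p (revealed I w p) = Some x"
proof -
  have "performs A I w (p @ [x]) \<and> A I p (revealed I w p) = Some x"
    using assms(1)
  proof (induction r rule: rev_induct)
    case Nil
    from Nil have "A I p (revealed I w p) = Some x"
      by (cases rule: performs.cases) (use assms(2) in auto)
    then show ?case using Nil by simp
  next
    case (snoc y r)
    from snoc.prems have "performs A I w (p @ x # r)"
    proof (cases rule: performs.cases)
      case (move p' v)
      then have "p' = p @ x # r"
        by (metis append_Cons append_assoc append1_eq_conv)
      then show ?thesis using move by simp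
    qed auto
    then show ?case by (rule snoc.IH)
  qed
  then show "performs A I w (p @ [x])" "A I p (revealed I w p) = Some x" by auto
qed

text \<open>Determinism: after a common prefix both runs get the same answer from \<open>A\<close>,
  and a run cannot have stopped where the other one moves on.\<close>

lemma performs_prefix_outputs:
  assumes "performs A I w p" "outputs A I w q"
  shows "\<exists>r. q = p @ r"
  using assms
proof (induction rule: performs.induct)
  case init
  then show ?case by (auto simp: outputs_def dest: performs_start)
next
  case (move p v)
  then obtain r where q: "q = p @ r" by blast
  have "p \<noteq> []" using move.hyps performs_start by blast
  show ?case
  proof (cases r)
    case Nil
    then show ?thesis using move q by (simp add: outputs_def)
  next
    case (Cons x r')
    then have "A I p (revealed I w p) = Some x"
      using performs_prefix(2)[of A I w p x r'] move.prems q \<open>p \<noteq> []\<close> by (simp add: outputs_def)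
    then show ?thesis using move.hyps q Cons by simp
  qed
qed

section \<open>The adversary\<close>

text \<open>\<open>takeWhile\<close> keeps the part of \<open>p\<close> before the first visit to an
  endpoint of \<open>e\<close>; its number of distinct vertices is the index of that endpoint in the
  order of first visits. An edge not met by \<open>p\<close> gets the price it would have if the
  next new vertex were an endpoint.\<close>

definition adversary_weight :: "real \<Rightarrow> 'v list \<Rightarrow> 'v set \<Rightarrow> real" where
  "adversary_weight \<alpha> p e = (if even (card (set (takeWhile (\<lambda>x. x \<notin> e) p))) then 1 else \<alpha>)"

lemma adversary_weight_bounds:
  "1 \<le> \<alpha> \<Longrightarrow> 1 \<le> adversary_weight \<alpha> p e \<and> adversary_weight \<alpha> p e \<le> \<alpha>"
  by (simp add: adversary_weight_def)

lemma adversary_weight_append: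
  assumes "e \<inter> set p \<noteq> {}"
  shows "adversary_weight \<alpha> (p @ r) e = adversary_weight \<alpha> p e"
proof -
  obtain x where "x \<in> set p" "x \<in> e" using assms by blast
  then have "takeWhile (\<lambda>x. x \<notin> e) (p @ r) = takeWhile (\<lambda>x. x \<notin> e) p"
    by (intro takeWhile_append1) auto
  then show ?thesis by (simp add: adversary_weight_def)
qed

lemma adversary_weight_new_edge:
  assumes "x \<notin> set p" "y \<notin> set p"
  shows "adversary_weight \<alpha> (p @ x # r) {x, y} = (if even (card (set p)) then 1 else \<alpha>)"
proof -
  have "takeWhile (\<lambda>z. z \<notin> {x, y}) (p @ x # r) = p"
    using assms by (subst takeWhile_append2) auto
  then show ?thesis by (simp only: adversary_weight_def)
qed

text \<open>
  The weights depend on the walk and the walk on the weights; extending the walk by one new vertex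
  at a time does not change the weights revealed before.
\<close>

lemma adversary_run_exists:
  assumes fin: "finite (vertices I)"
    and meet: "\<And>e. e \<in> edges I \<Longrightarrow> e \<inter> vertices I \<noteq> {}"
    and solves: "\<And>p. solves A I (adversary_weight \<alpha> p)"
  shows "\<exists>q. outputs A I (adversary_weight \<alpha> q) q \<and> exploration_walk I q"
proof -
  let ?W = "adversary_weight \<alpha>"
  have extend: "\<exists>r. outputs A I (?W p) (p @ r) \<and> exploration_walk I (p @ r)"
    if "performs A I (?W p) p" for p
    using solves[of p] performs_prefix_outputs[OF that] unfolding solves_def by blast
  have "\<exists>p. performs A I (?W p) p \<and> k \<le> card (set p)" if "k \<le> card (vertices I)" for k
    using that
  proof (induction k)
    case 0
    show ?case using performs.init[of A I "?W [start I]"] by auto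
  next
    case (Suc k)
    then obtain p where p: "performs A I (?W p) p" "k \<le> card (set p)" by auto
    show ?case
    proof (cases "Suc k \<le> card (set p)")
      case True
      then show ?thesis using p by blast
    next
      case False
      obtain r where r: "outputs A I (?W p) (p @ r)" "exploration_walk I (p @ r)"
        using extend[OF p(1)] by blast
      have set: "set p \<union> set r = vertices I" using r(2) by (simp add: exploration_walk_def)
      have "set p \<noteq> vertices I" using False Suc.prems by auto
      then have "\<exists>x\<in>set r. x \<notin> set p" using set by blast
      \<comment> \<open>Up to the first new vertex \<open>v\<close> the run only revisits vertices
        of \<open>p\<close>, so every weight it has used is already fixed by
        \<open>p\<close>.\<close>
      then obtain r1 v r2 where v: "r = r1 @ v # r2" "v \<notin> set p" "\<forall>x\<in>set r1. x \<in> set p"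
        using split_list_first_prop[of r "\<lambda>x. x \<notin> set p"] by auto
      have "p \<noteq> []" using p(1) performs_start by blast
      have "performs A I (?W p) ((p @ r1) @ [v])"
        by (rule performs_prefix(1)[where r = r2])
          (use r(1) v(1) \<open>p \<noteq> []\<close> in \<open>auto simp: outputs_def\<close>)
      then have "performs A I (?W ((p @ r1) @ [v])) ((p @ r1) @ [v])"
      proof (rule performs_cong)
        fix e assume "e \<in> edges I" "e \<inter> set (butlast ((p @ r1) @ [v])) \<noteq> {}"
        then have "e \<inter> set p \<noteq> {}" using v(3) by (auto simp: butlast_append)
        then show "?W p e = ?W ((p @ r1) @ [v]) e"
          using adversary_weight_append[of e p \<alpha> "r1 @ [v]"] by simp
      qed
      moreover have "set ((p @ r1) @ [v]) = insert v (set p)" using v(3) by auto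
      then have "Suc k \<le> card (set ((p @ r1) @ [v]))" using v(2) p(2) by simp
      ultimately show ?thesis by blast
    qed
  qed
  then obtain p where p: "performs A I (?W p) p" "card (vertices I) \<le> card (set p)" by blast
  obtain r where r: "outputs A I (?W p) (p @ r)" "exploration_walk I (p @ r)"
    using extend[OF p(1)] by blast
  have "set p \<subseteq> vertices I" using r(2) by (auto simp: exploration_walk_def)
  then have "set p = vertices I" using p(2) fin card_seteq by blast
  \<comment> \<open>No weight can change any more, so the completion of \<open>p\<close> under the
    weights of \<open>p\<close> is also a run under its own weights.\<close>
  then have agree: "?W p e = ?W (p @ r) e" if "e \<in> edges I" for e
    using adversary_weight_append[of e p \<alpha> r] meet[OF that] by simp
  have "performs A I (?W (p @ r)) (p @ r)"
    using r(1) agree performs_cong[of A I "?W p" "p @ r" "?W (p @ r)"] by (simp add: outputs_def)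
  moreover have "revealed I (?W p) (p @ r) = revealed I (?W (p @ r)) (p @ r)"
    by (rule revealed_cong) (rule agree)
  ultimately have "outputs A I (?W (p @ r)) (p @ r)"
    using r(1) by (simp add: outputs_def)
  then show ?thesis using r(2) by blast
qed

text \<open>
  The correction for an even number of vertices reflects that \<open>1\<close> is paid before \<open>\<alpha>\<close>; the last
  summand pays for the first edge of a detour, which allows to charge \<open>2 \<ge> \<alpha>\<close> for the whole detour.
\<close>

lemma adversary_cost_ge:
  assumes "1 \<le> \<alpha>" "\<alpha> \<le> 2" "p \<noteq> []"
  shows "walk_cost (adversary_weight \<alpha> (p @ r)) p \<ge>
    (real (card (set p)) - 1) * (\<alpha> + 1) / 2 - (if even (card (set p)) then (\<alpha> - 1) / 2 else 0)
    + (if last p \<in> set (butlast p) then 1 else 0)"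
  using assms(3)
proof (induction p arbitrary: r rule: rev_induct)
  case (snoc v p)
  show ?case
  proof (cases "p = []")
    case True
    then show ?thesis by (simp add: walk_cost_def)
  next
    case False
    let ?w = "adversary_weight \<alpha> ((p @ [v]) @ r)"
    have IH: "walk_cost ?w p \<ge>
      (real (card (set p)) - 1) * (\<alpha> + 1) / 2 - (if even (card (set p)) then (\<alpha> - 1) / 2 else 0)
      + (if last p \<in> set (butlast p) then 1 else 0)"
      using snoc.IH[of "v # r"] False by simp
    have cost: "walk_cost ?w (p @ [v]) = walk_cost ?w p + ?w {last p, v}"
      using walk_cost_snoc[OF False] by blast
    have w1: "?w {last p, v} \<ge> 1" using adversary_weight_bounds[OF assms(1)] by blast
    show ?thesis
    \<comment> \<open>Apart from its last summand, the bound grows by 1 from an odd number of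
      visited vertices, by \<open>\<alpha>\<close> from an even number, and not at all at a revisit,
      whose edge pays for the summand 1.\<close>
    proof (cases "v \<in> set p")
      case True
      then have "set (p @ [v]) = set p" by auto
      then show ?thesis using IH cost w1 True by (auto split: if_splits)
    next
      case new: False
      then have card: "card (set (p @ [v])) = Suc (card (set p))" by simp
      show ?thesis
      proof (cases "last p \<in> set (butlast p)")
        case True
        \<comment> \<open>The summand 1 and the edge to \<open>v\<close>, of weight at least 1, give
          2, which covers either growth.\<close>
        then show ?thesis
          using IH w1 new assms(1,2) unfolding cost card
          by (auto simp: field_simps split: if_splits)
      next
        case False
        \<comment> \<open>\<open>last p\<close> is a first visit here, so the size of
          \<open>set b\<close> sets the price of its edge to \<open>v\<close>. Being one less than
          the size of \<open>set p\<close>, it makes this price equal to the growth of the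
          bound.\<close>
        define b where "b = butlast p"
        have p: "p = b @ [last p]" using \<open>p \<noteq> []\<close> by (simp add: b_def)
        have "v \<notin> set b" using new b_def in_set_butlastD by fast
        then have "adversary_weight \<alpha> (b @ last p # v # r) {last p, v} =
            (if even (card (set b)) then 1 else \<alpha>)"
          using False by (intro adversary_weight_new_edge) (simp_all add: b_def)
        moreover have "b @ last p # v # r = (p @ [v]) @ r" using \<open>p \<noteq> []\<close> by (simp add: b_def)
        ultimately have "?w {last p, v} = (if even (card (set b)) then 1 else \<alpha>)" by metis
        moreover have "set p = insert (last p) (set b)" by (subst p) simp
        then have "card (set p) = Suc (card (set b))" using False b_def by simp
        ultimately have "?w {last p, v} = (if even (card (set p)) then \<alpha> else 1)" by simp
        then show ?thesis
          using IH new False unfolding cost card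
          by (auto simp: field_simps split: if_splits)
      qed
    qed
  qed
qed simp

text \<open>Before an edge from \<open>\<sigma> ! i\<close> to a vertex not among the first
  \<open>i\<close> is met, exactly \<open>i\<close> vertices have been visited. Prices thus depend
  on indices only, as the construction of the tour requires.\<close>

lemma first_visit_order:
  assumes "p \<noteq> []"
  shows "\<exists>\<sigma>. distinct \<sigma> \<and> set \<sigma> = set p \<and> \<sigma> ! 0 = hd p \<and>
    (\<forall>i<length \<sigma>. \<forall>y. y \<notin> set (take i \<sigma>) \<longrightarrow>
       adversary_weight \<alpha> p {\<sigma> ! i, y} = (if even i then 1 else \<alpha>))"
  using assms
proof (induction p rule: rev_induct)
  case (snoc v p)
  show ?case
  proof (cases "p = []")
    case True
    then show ?thesis by (intro exI[of _ "[v]"]) (simp add: adversary_weight_def)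
  next
    case False
    then obtain \<sigma> where \<sigma>: "distinct \<sigma>" "set \<sigma> = set p" "\<sigma> ! 0 = hd p"
      "\<And>i y. i < length \<sigma> \<Longrightarrow> y \<notin> set (take i \<sigma>) \<Longrightarrow>
         adversary_weight \<alpha> p {\<sigma> ! i, y} = (if even i then 1 else \<alpha>)"
      using snoc.IH by blast
    have old: "adversary_weight \<alpha> (p @ [v]) {\<sigma> ! i, y} = (if even i then 1 else \<alpha>)"
      if "i < length \<sigma>" "y \<notin> set (take i \<sigma>)" for i y
    proof -
      have "\<sigma> ! i \<in> set p" using that \<sigma>(2) nth_mem by blast
      then show ?thesis using adversary_weight_append[of "{\<sigma> ! i, y}" p] \<sigma>(4)[OF that] by simp
    qed
    show ?thesis
    proof (cases "v \<in> set p")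
      case True
      then show ?thesis using \<sigma> old False by (intro exI[of _ \<sigma>]) auto
    next
      case new: False
      have len: "card (set p) = length \<sigma>" using \<sigma>(1,2) distinct_card by metis
      have "\<sigma> \<noteq> []" using \<sigma>(2) False by auto
      have "adversary_weight \<alpha> (p @ [v]) {(\<sigma> @ [v]) ! i, y} = (if even i then 1 else \<alpha>)"
        if i: "i < length (\<sigma> @ [v])" and y: "y \<notin> set (take i (\<sigma> @ [v]))" for i y
      proof (cases "i < length \<sigma>")
        case True
        then show ?thesis using old y by (simp add: nth_append)
      next
        case False
        then have "i = length \<sigma>" using i by simp
        then show ?thesis
          using adversary_weight_new_edge[of v p y \<alpha> "[]"] new y \<sigma>(2) len by simp
      qed
      then show ?thesis
        using \<sigma> new False \<open>\<sigma> \<noteq> []\<close> by (intro exI[of _ "\<sigma> @ [v]"]) (auto simp: nth_append)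
    qed
  qed
qed simp

section \<open>The cheap tour\<close>

primrec tour :: "(nat \<Rightarrow> 'v) \<Rightarrow> nat \<Rightarrow> 'v list" where
  "tour \<sigma> 0 = [\<sigma> 0]"
| "tour \<sigma> (Suc k) = tour \<sigma> k @ [\<sigma> (2 * k + 1), \<sigma> (2 * k)]"

lemma hd_tour: "tour \<sigma> k \<noteq> [] \<and> hd (tour \<sigma> k) = \<sigma> 0"
  by (induction k) auto

text \<open>For \<open>k = 0\<close> truncated subtraction gives index 0, so the first round fits
  the general pattern.\<close>

lemma last_tour: "last (tour \<sigma> k) = \<sigma> (2 * (k - 1))"
  by (cases k) auto

lemma set_tour: "0 < k \<Longrightarrow> set (tour \<sigma> k) = \<sigma> ` {..<2 * k}"
proof (induction k)
  case (Suc k)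
  have "{..<2 * Suc k} = insert (2 * k + 1) (insert (2 * k) {..<2 * k})" by auto
  then show ?case using Suc by (cases "k = 0") auto
qed simp

lemma successively_snoc:
  "p \<noteq> [] \<Longrightarrow> successively P (p @ [x]) \<longleftrightarrow> successively P p \<and> P (last p) x"
  by (simp add: successively_append_iff)

text \<open>Round \<open>k\<close> goes from index \<open>2 * (k - 1)\<close> to
  \<open>2 * k + 1\<close> and on to \<open>2 * k\<close>; the smaller index is even in both
  steps.\<close>

lemma tour_cheap:
  assumes edge: "\<And>i j. i < n \<Longrightarrow> j < n \<Longrightarrow> i \<noteq> j \<Longrightarrow> {\<sigma> i, \<sigma> j} \<in> E"
    and cheap: "\<And>i j. i < j \<Longrightarrow> j < n \<Longrightarrow> even i \<Longrightarrow> w {\<sigma> i, \<sigma> j} = 1"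
    and "2 * k \<le> n"
  shows "successively (\<lambda>x y. {x, y} \<in> E) (tour \<sigma> k) \<and> walk_cost w (tour \<sigma> k) = 2 * real k"
  using assms(3)
proof (induction k)
  case 0
  show ?case by (simp add: walk_cost_def)
next
  case (Suc k)
  let ?p = "tour \<sigma> k" and ?q = "tour \<sigma> k @ [\<sigma> (2 * k + 1)]"
  have tour: "tour \<sigma> (Suc k) = ?q @ [\<sigma> (2 * k)]" by simp
  have ne: "?p \<noteq> []" using hd_tour by blast
  have 1: "{last ?p, \<sigma> (2 * k + 1)} \<in> E" "w {last ?p, \<sigma> (2 * k + 1)} = 1"
    unfolding last_tour using Suc.prems by (auto intro!: edge cheap)
  have 2: "{\<sigma> (2 * k + 1), \<sigma> (2 * k)} \<in> E" "w {\<sigma> (2 * k + 1), \<sigma> (2 * k)} = 1"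
    using Suc.prems cheap[of "2 * k" "2 * k + 1"] by (auto intro!: edge simp: insert_commute)
  have IH: "successively (\<lambda>x y. {x, y} \<in> E) ?p" "walk_cost w ?p = 2 * real k"
    using Suc by auto
  have q: "successively (\<lambda>x y. {x, y} \<in> E) ?q" "walk_cost w ?q = 2 * real k + 1"
    using IH 1 by (simp_all only: successively_snoc[OF ne] walk_cost_snoc[OF ne])
  have "?q \<noteq> []" by simp
  from q 2 show ?case
    unfolding tour successively_snoc[OF \<open>?q \<noteq> []\<close>] walk_cost_snoc[OF \<open>?q \<noteq> []\<close>] by simp
qed

lemma cheap_exploration_walk:
  assumes "2 \<le> m"
    and vertices: "\<sigma> ` {..<2 * m} = vertices I" "\<sigma> 0 = start I" "start I = target I"
    and edge: "\<And>i j. i < 2 * m \<Longrightarrow> j < 2 * m \<Longrightarrow> i \<noteq> j \<Longrightarrow> {\<sigma> i, \<sigma> j} \<in> edges I"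
    and cheap: "\<And>i j. i < j \<Longrightarrow> j < 2 * m \<Longrightarrow> even i \<Longrightarrow> w {\<sigma> i, \<sigma> j} = 1"
  shows "\<exists>p. exploration_walk I p \<and> walk_cost w p = 2 * real m + 1"
proof -
  let ?p = "tour \<sigma> m"
  have ne: "?p \<noteq> []" and hd: "hd ?p = \<sigma> 0" using hd_tour by metis+
  have tour: "successively (\<lambda>x y. {x, y} \<in> edges I) ?p" "walk_cost w ?p = 2 * real m"
    using tour_cheap[of "2 * m" \<sigma> "edges I" w m] edge cheap by auto
  \<comment> \<open>The tour ends at index \<open>2 * (m - 1)\<close>, which
    \<open>2 \<le> m\<close> keeps distinct from 0, so the way back is a single edge.\<close>
  have closing: "{last ?p, \<sigma> 0} \<in> edges I" "w {last ?p, \<sigma> 0} = 1"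
    unfolding last_tour using assms(1) cheap[of 0 "2 * (m - 1)"]
    by (auto intro!: edge simp: insert_commute)
  have set: "set ?p = vertices I" using set_tour[of m \<sigma>] vertices assms(1) by simp
  have "\<sigma> 0 \<in> vertices I" using set hd ne hd_in_set by metis
  then have "exploration_walk I (?p @ [\<sigma> 0])"
    using ne hd set vertices tour(1) closing(1)
    by (auto simp: exploration_walk_def is_walk_def successively_snoc)
  moreover have "walk_cost w (?p @ [\<sigma> 0]) = 2 * real m + 1"
    by (simp add: walk_cost_snoc[OF ne] tour closing)
  ultimately show ?thesis by blast
qed

section \<open>The lower bound\<close>

theorem theorem4:
  fixes \<alpha> c :: real and A :: "('v::infinite) online_algorithm"
  assumes "1 \<le> \<alpha>" and "\<alpha> \<le> 2" and "c < (\<alpha> + 1) / 2"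
    and "\<And>I w. uniform_complete_instance \<alpha> I w \<Longrightarrow> solves A I w"
  shows "\<exists>I w p. uniform_complete_instance \<alpha> I w \<and> outputs A I w p \<and>
           walk_cost w p > c * opt I w"
proof -
  \<comment> \<open>Replacing \<open>c\<close> by the nonnegative \<open>d\<close> allows
    multiplying an upper bound on \<open>opt\<close> by it.\<close>
  define a d where "a = (\<alpha> + 1) / 2" and "d = max c 0"
  have d: "0 \<le> d" "c \<le> d" "d < a" using assms(1,3) by (auto simp: a_def d_def)
  \<comment> \<open>The aim \<open>d * (2 * m + 1) < (2 * m - 1) * a - 1 / 2\<close> amounts to
    \<open>d + a + 1 / 2 < 2 * m * (a - d)\<close>.\<close>
  obtain k :: nat where k: "(d + a + 1) / (a - d) < real k" using reals_Archimedean2 by blast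
  define m where "m = k + 2"
  have "d + a + 1 < real k * (a - d)" using k d(3) by (simp add: field_simps)
  also have "\<dots> \<le> (2 * real m) * (a - d)"
    using d(3) by (intro mult_right_mono) (auto simp: m_def)
  finally have m: "d * (2 * real m + 1) < (2 * real m - 1) * a - 1 / 2"
    by (simp add: algebra_simps)
  obtain V :: "'v set" where V: "finite V" "card V = 2 * m"
    using infinite_arbitrarily_large[OF infinite_UNIV] by blast
  obtain s where s: "s \<in> V" using V by (fastforce simp: m_def)
  define I where "I = \<lparr>vertices = V, edges = {e. e \<subseteq> V \<and> card e = 2},
    lower = (\<lambda>_. 1), upper = (\<lambda>_. \<alpha>), start = s, target = s\<rparr>"
  have conn: "connected_graph I"
    unfolding connected_graph_def
  proof (intro ballI)
    fix x y assume xy: "x \<in> vertices I" "y \<in> vertices I"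
    show "\<exists>p. is_walk I p \<and> hd p = x \<and> last p = y"
    proof (cases "x = y")
      case True
      then show ?thesis using xy by (intro exI[of _ "[x]"]) (auto simp: is_walk_def)
    next
      case False
      then show ?thesis using xy by (intro exI[of _ "[x, y]"]) (auto simp: is_walk_def I_def)
    qed
  qed
  have inst: "uniform_complete_instance \<alpha> I (adversary_weight \<alpha> p)" for p
    using conn V(1) s adversary_weight_bounds[OF assms(1)]
    by (auto simp: uniform_complete_instance_def geewe_instance_def I_def)
  have "e \<inter> vertices I \<noteq> {}" if "e \<in> edges I" for e
  proof -
    have "e \<noteq> {}" using that by (auto simp: I_def)
    then show ?thesis using that by (auto simp: I_def)
  qed
  then obtain q where q: "outputs A I (adversary_weight \<alpha> q) q" "exploration_walk I q"
    using adversary_run_exists[of I A \<alpha>] V(1) assms(4)[OF inst] by (auto simp: I_def)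
  let ?w = "adversary_weight \<alpha> q"
  have qV: "q \<noteq> []" "set q = V" "hd q = s"
    using q(2) by (auto simp: exploration_walk_def is_walk_def I_def)
  \<comment> \<open>The correction \<open>(\<alpha> - 1) / 2\<close> for the even number of vertices
    is at most 1/2.\<close>
  have "(2 * real m - 1) * a - 1 / 2 \<le> walk_cost ?w q"
    using adversary_cost_ge[OF assms(1,2) qV(1), of "[]"] assms(1,2) qV(2) V(2)
    by (auto simp: a_def field_simps split: if_splits)
  moreover have "c * opt I ?w \<le> d * (2 * real m + 1)"
  proof -
    obtain \<sigma> where \<sigma>: "distinct \<sigma>" "set \<sigma> = V" "\<sigma> ! 0 = s"
      "\<And>i y. i < length \<sigma> \<Longrightarrow> y \<notin> set (take i \<sigma>) \<Longrightarrow> ?w {\<sigma> ! i, y} = (if even i then 1 else \<alpha>)"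
      using first_visit_order[OF qV(1)] qV(2,3) by metis
    have len: "length \<sigma> = 2 * m" using \<sigma>(1,2) V(2) distinct_card by metis
    have "\<exists>p. exploration_walk I p \<and> walk_cost ?w p = 2 * real m + 1"
    proof (rule cheap_exploration_walk[where \<sigma> = "\<lambda>i. \<sigma> ! i"])
      show "2 \<le> m" by (simp add: m_def)
      show "(!) \<sigma> ` {..<2 * m} = vertices I"
        using \<sigma>(2) len by (auto simp: I_def set_conv_nth image_def)
      show "\<sigma> ! 0 = start I" "start I = target I" using \<sigma>(3) by (auto simp: I_def)
      show "{\<sigma> ! i, \<sigma> ! j} \<in> edges I" if "i < 2 * m" "j < 2 * m" "i \<noteq> j" for i j
        using that \<sigma>(1,2) len nth_mem by (auto simp: I_def nth_eq_iff_index_eq card_insert_if)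
      show "?w {\<sigma> ! i, \<sigma> ! j} = 1" if "i < j" "j < 2 * m" "even i" for i j
      proof -
        have "\<sigma> ! j \<notin> set (take i \<sigma>)"
          using that \<sigma>(1) len by (auto simp: in_set_conv_nth nth_eq_iff_index_eq)
        then show ?thesis using \<sigma>(4)[of i "\<sigma> ! j"] that len by simp
      qed
    qed
    then obtain p where p: "exploration_walk I p" "walk_cost ?w p = 2 * real m + 1" by blast
    \<comment> \<open>Weights of at least 1 make the infimum an attained, nonnegative minimum, so
      that \<open>c \<le> d\<close> carries over to the products with \<open>opt\<close>.\<close>
    have ge1: "\<forall>e\<in>edges I. 1 \<le> ?w e" using adversary_weight_bounds[OF assms(1)] by blast
    then have "\<forall>e\<in>edges I. 0 < ?w e" by force
    then obtain o' where o': "exploration_walk I o'" "walk_cost ?w o' = opt I ?w"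
      "\<And>p. exploration_walk I p \<Longrightarrow> walk_cost ?w o' \<le> walk_cost ?w p"
      using opt_attained[of I ?w] inst[of q] unfolding uniform_complete_instance_def by blast
    have "is_walk I o'" "o' \<noteq> []" using o'(1) by (auto simp: exploration_walk_def is_walk_def)
    then have "real (length o') - 1 \<le> opt I ?w" "1 \<le> real (length o')"
      using walk_cost_ge_length[OF ge1, of o'] o'(2) by (auto simp: Suc_le_eq)
    then have "0 \<le> opt I ?w" by linarith
    moreover have "opt I ?w \<le> 2 * real m + 1" using o'(2,3) p by metis
    ultimately show ?thesis using d by (intro mult_mono) auto
  qed
  ultimately have "c * opt I ?w < walk_cost ?w q" using m by linarith
  then show ?thesis using inst q(1) by blast
qed

end
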